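(* Let $G_1=(V_1,E_1,w)$ and $G_2=(V_2,E_2,\overline{w})$ be two weighted graphs (possibly infinite, locally finite), let $K_1,K_2\in\mathbb{R}$ and let $n_1,n_2\in(0,\infty]$. If $(G_1,\mathbf{1}_{V_1})$ satisfies $CD(K_1,n_1)$ and $(G_2,\mathbf{1}_{V_2})$ satisfies $CD(K_2,n_2)$, then the Cartesian product $(G_1\times G_2,\mathbf{1}_{V_1\times V_2})$ satisfies $CD(K_1\wedge K_2,\,n_1+n_2)$, where $K_1\wedge K_2:=\min\{K_1,K_2\}$.
   Context: A weighted graph $G=(V,E,w)$ is an undirected connected graph, with adjacency relation $\sim$ and symmetric edge weights $w:V\times V\to\mathbb{R}_{\ge 0}$ with $w_{xy}=w_{yx}>0$ if and only if $x\sim y$. For a positive vertex measure $\mu:V\to\mathbb{R}_{>0}$, the Laplacian of $(G,\mu)$ is $\Delta f(x)=\frac{1}{\mu(x)}\sum_{y,y\sim x}w_{xy}(f(y)-f(x))$ for $f:V\to\mathbb{R}$. $\mathbf{1}_V$ denotes the vertex measure $\mu(x)=1$ for all $x\in V$. Define $\Gamma(f,g):=\frac12\{\Delta(fg)-f\Delta g-g\Delta f\}$, $\Gamma_2(f,g):=\frac12\{\Delta\Gamma(f,g)-\Gamma(f,\Delta g)-\Gamma(g,\Delta f)\}$, $\Gamma(f):=\Gamma(f,f)$, $\Gamma_2(f):=\Gamma_2(f,f)$. $(G,\mu)$ satisfies $CD(K,n)$ if for all $f:V\to\mathbb{R}$ and all $x\in V$, $\Gamma_2(f)(x)\ge\frac1n(\Delta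 f(x))^2+K\Gamma(f)(x)$, where for $n=\infty$ one sets $\frac1n=0$. The Cartesian product $G_1\times G_2$ is the weighted graph with vertex set $V_1\times V_2$ in which $(x_1,y_1)$ and $(x_2,y_2)$ are adjacent if either $x_1=x_2$ and $y_1\sim y_2$ in $G_2$ (with edge weight $\overline{w}_{y_1y_2}$), or $x_1\sim x_2$ in $G_1$ and $y_1=y_2$ (with edge weight $w_{x_1x_2}$). *)

theory Defs
  imports Complex_Main "HOL-Library.Extended_Real"
begin

record 'a wgraph =
  verts :: "'a set"
  edges :: "('a \<times> 'a) set"
  weight :: "'a \<Rightarrow> 'a \<Rightarrow> real"

text \<open>
  Both orientations of an undirected edge belong to \<open>edges\<close>. Loops are not excluded;
  they do not contribute to the Laplacian below.
\<close>

locale weighted_graph =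
  fixes G :: "'a wgraph"
  assumes edges_subset: "edges G \<subseteq> verts G \<times> verts G"
    and sym_edges: "sym (edges G)"
    and connected: "\<lbrakk>x \<in> verts G; y \<in> verts G\<rbrakk> \<Longrightarrow> (x, y) \<in> (edges G)\<^sup>*"
    and weight_nonneg: "\<lbrakk>x \<in> verts G; y \<in> verts G\<rbrakk> \<Longrightarrow> weight G x y \<ge> 0"
    and weight_sym: "\<lbrakk>x \<in> verts G; y \<in> verts G\<rbrakk> \<Longrightarrow> weight G x y = weight G y x"
    and weight_pos_iff: "\<lbrakk>x \<in> verts G; y \<in> verts G\<rbrakk> \<Longrightarrow> weight G x y > 0 \<longleftrightarrow> (x, y) \<in> edges G"

definition locally_finite :: "'a wgraph \<Rightarrow> bool" where
  "locally_finite G \<longleftrightarrow> (\<forall>x\<in>verts G. finite {y. (x, y) \<in> edges G})"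

text \<open>
  Functions on the vertex set are represented by total functions on the vertex type. At a
  vertex of a weighted graph, the operators below only depend on values at vertices.
\<close>

definition laplacian :: "'a wgraph \<Rightarrow> ('a \<Rightarrow> real) \<Rightarrow> ('a \<Rightarrow> real) \<Rightarrow> 'a \<Rightarrow> real" where
  "laplacian G \<mu> f x = 1 / \<mu> x * (\<Sum>y | (x, y) \<in> edges G. weight G x y * (f y - f x))"

definition Gamma :: "'a wgraph \<Rightarrow> ('a \<Rightarrow> real) \<Rightarrow> ('a \<Rightarrow> real) \<Rightarrow> ('a \<Rightarrow> real) \<Rightarrow> 'a \<Rightarrow> real" where
  "Gamma G \<mu> f g x =
     1 / 2 * (laplacian G \<mu> (\<lambda>z. f z * g z) x - f x * laplacian G \<mu> g x - g x * laplacian G \<mu> f x)"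

definition Gamma2 :: "'a wgraph \<Rightarrow> ('a \<Rightarrow> real) \<Rightarrow> ('a \<Rightarrow> real) \<Rightarrow> ('a \<Rightarrow> real) \<Rightarrow> 'a \<Rightarrow> real" where
  "Gamma2 G \<mu> f g x =
     1 / 2 * (laplacian G \<mu> (Gamma G \<mu> f g) x
       - Gamma G \<mu> f (laplacian G \<mu> g) x - Gamma G \<mu> g (laplacian G \<mu> f) x)"

text \<open>In \<^typ>\<open>ereal\<close> one has \<open>1 / \<infinity> = 0\<close>. The dimension is meant to satisfy \<open>0 < n\<close>.\<close>

definition CD :: "'a wgraph \<Rightarrow> ('a \<Rightarrow> real) \<Rightarrow> real \<Rightarrow> ereal \<Rightarrow> bool" where
  "CD G \<mu> K n \<longleftrightarrow>
     (\<forall>f. \<forall>x\<in>verts G.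
        Gamma2 G \<mu> f f x \<ge> real_of_ereal (1 / n) * (laplacian G \<mu> f x)\<^sup>2 + K * Gamma G \<mu> f f x)"

text \<open>
  The two kinds of product edges overlap only at loops, whose weight is irrelevant to the
  Laplacian; there the weight of the second factor is used.
\<close>

definition cart_prod :: "'a wgraph \<Rightarrow> 'b wgraph \<Rightarrow> ('a \<times> 'b) wgraph" where
  "cart_prod G H =
     \<lparr>verts = verts G \<times> verts H,
      edges = {((x1, y1), (x2, y2)) | x1 y1 x2 y2.
         (x1 \<in> verts G \<and> x1 = x2 \<and> (y1, y2) \<in> edges H) \<or>
         ((x1, x2) \<in> edges G \<and> y1 \<in> verts H \<and> y1 = y2)},
      weight = (\<lambda>(x1, y1) (x2, y2).
         if x1 = x2 \<and> (y1, y2) \<in> edges H then weight H y1 y2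
         else if (x1, x2) \<in> edges G \<and> y1 = y2 then weight G x1 x2
         else 0)\<rparr>"

lemma weighted_graph_cart_prod:
  assumes "weighted_graph G" and "weighted_graph H"
  shows "weighted_graph (cart_prod G H)"
proof -
  interpret G: weighted_graph G by fact
  interpret H: weighted_graph H by fact
  let ?E = "edges (cart_prod G H)"
  have right: "((x, y), (x, y')) \<in> ?E\<^sup>*" if "x \<in> verts G" "(y, y') \<in> (edges H)\<^sup>*" for x y y'
    using that(2)
  proof (induction rule: rtrancl_induct)
    case (step u v)
    have "((x, u), (x, v)) \<in> ?E"
      using step.hyps that(1) by (auto simp: cart_prod_def)
    with step.IH show ?case by (rule rtrancl_into_rtrancl)
  qed simp
  have left: "((x, y), (x', y)) \<in> ?E\<^sup>*" if "y \<in> verts H" "(x, x') \<in> (edges G)\<^sup>*" for x x' y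
    using that(2)
  proof (induction rule: rtrancl_induct)
    case (step u v)
    have "((u, y), (v, y)) \<in> ?E"
      using step.hyps that(1) by (auto simp: cart_prod_def)
    with step.IH show ?case by (rule rtrancl_into_rtrancl)
  qed simp
  show ?thesis
  proof
    show "?E \<subseteq> verts (cart_prod G H) \<times> verts (cart_prod G H)"
      using G.edges_subset H.edges_subset by (auto simp: cart_prod_def)
    show "sym ?E"
      using G.sym_edges H.sym_edges by (auto simp: cart_prod_def sym_def)
  next
    fix p q assume pq: "p \<in> verts (cart_prod G H)" "q \<in> verts (cart_prod G H)"
    obtain x1 y1 x2 y2 where eq: "p = (x1, y1)" "q = (x2, y2)"
      by (cases p, cases q)
    have V: "x1 \<in> verts G" "x2 \<in> verts G" "y1 \<in> verts H" "y2 \<in> verts H"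
      using pq by (auto simp: cart_prod_def eq)
    have "(p, (x2, y1)) \<in> ?E\<^sup>*" "((x2, y1), q) \<in> ?E\<^sup>*"
      unfolding eq using V by (auto intro!: left right G.connected H.connected)
    then show "(p, q) \<in> ?E\<^sup>*" by (rule rtrancl_trans)
    have symG: "(x1, x2) \<in> edges G \<longleftrightarrow> (x2, x1) \<in> edges G"
      and symH: "(y1, y2) \<in> edges H \<longleftrightarrow> (y2, y1) \<in> edges H"
      using G.sym_edges H.sym_edges by (auto dest: symD)
    show "weight (cart_prod G H) p q \<ge> 0"
      using V by (simp add: cart_prod_def eq G.weight_nonneg H.weight_nonneg)
    show "weight (cart_prod G H) p q = weight (cart_prod G H) q p"
      using V symG symH G.weight_sym[of x1 x2] H.weight_sym[of y1 y2]
      by (auto simp: cart_prod_def eq)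
    show "weight (cart_prod G H) p q > 0 \<longleftrightarrow> (p, q) \<in> ?E"
      using V G.weight_pos_iff[of x1 x2] H.weight_pos_iff[of y1 y2]
      by (auto simp: cart_prod_def eq)
  qed
qed

end

theory Submission imports Defs begin

text \<open>
  The product Laplacian is the sum of the two Laplacians acting in one variable each. So
  \<open>\<Gamma>\<close> of the product is also the sum of its one-variable counterparts, and
  \<open>\<Gamma>\<^sub>2(F)\<close> is the sum of the \<open>\<Gamma>\<^sub>2\<close> of the two restrictions of \<open>F\<close> through the point, plus
  two mixed terms, in which one factor contributes the Laplacian and the other the \<open>\<Gamma>\<close>
  (\<open>Gamma2_cart_prod\<close>). Because the Laplacian in one variable commutes with taking
  differences in the other, a mixed term is a weighted sum of squares of mixed second differences
  \<open>F (x', y') - F (x', y) - F (x, y') + F (x, y)\<close>, and hence nonnegative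
  (\<open>mixed_term_nonneg\<close>).

  It remains to add the two curvature-dimension inequalities for the restrictions. Since
  \<open>\<Gamma> \<ge> 0\<close>, both curvature bounds may be lowered to their minimum, and the dimension terms
  combine by \<open>u\<^sup>2 / n\<^sub>1 + v\<^sup>2 / n\<^sub>2 \<ge> (u + v)\<^sup>2 / (n\<^sub>1 + n\<^sub>2)\<close>
  (\<open>square_add_div_le\<close>).
\<close>

section \<open>The operators on a single graph\<close>

lemma laplacian_cong:
  assumes "weighted_graph G" "x \<in> verts G" "\<And>z. z \<in> verts G \<Longrightarrow> f z = g z"
  shows "laplacian G \<mu> f x = laplacian G \<mu> g x"
proof -
  have "(x, y) \<in> edges G \<Longrightarrow> f y = g y" for y
    using assms(3) weighted_graph.edges_subset[OF assms(1)] by blast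
  then show ?thesis
    unfolding laplacian_def by (simp add: assms)
qed

lemma Gamma_cong:
  assumes "weighted_graph G" "x \<in> verts G" "\<And>z. z \<in> verts G \<Longrightarrow> g z = h z"
  shows "Gamma G \<mu> f g x = Gamma G \<mu> f h x"
  unfolding Gamma_def
  using laplacian_cong[OF assms(1,2), of g h \<mu>] laplacian_cong[OF assms(1,2), of "\<lambda>z. f z * g z" "\<lambda>z. f z * h z" \<mu>]
  by (simp add: assms)

lemma laplacian_add:
  "laplacian G \<mu> (\<lambda>z. f z + g z) x = laplacian G \<mu> f x + laplacian G \<mu> g x"
proof -
  have "(\<Sum>y | (x, y) \<in> edges G. weight G x y * ((f y + g y) - (f x + g x))) =
    (\<Sum>y | (x, y) \<in> edges G. weight G x y * (f y - f x) + weight G x y * (g y - g x))"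
    by (rule sum.cong) (auto simp: algebra_simps)
  then show ?thesis
    unfolding laplacian_def by (simp only: sum.distrib distrib_left)
qed

lemma Gamma_add_right:
  "Gamma G \<mu> f (\<lambda>z. g z + h z) x = Gamma G \<mu> f g x + Gamma G \<mu> f h x"
proof -
  have "laplacian G \<mu> (\<lambda>z. f z * (g z + h z)) x =
    laplacian G \<mu> (\<lambda>z. f z * g z) x + laplacian G \<mu> (\<lambda>z. f z * h z) x"
    using laplacian_add[of G \<mu> "\<lambda>z. f z * g z" "\<lambda>z. f z * h z" x] by (simp add: distrib_left)
  then show ?thesis
    unfolding Gamma_def by (simp add: laplacian_add algebra_simps)
qed

text \<open>
  The product rule for differences is
  \<open>f y * g y - f x * g x = f x * (g y - g x) + g x * (f y - f x) + (f y - f x) * (g y - g x)\<close>,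
  and \<open>\<Gamma>\<close> retains only its last term.
\<close>

lemma Gamma_eq_sum:
  "Gamma G \<mu> f g x =
    1 / (2 * \<mu> x) * (\<Sum>y | (x, y) \<in> edges G. weight G x y * (f y - f x) * (g y - g x))"
proof -
  let ?S = "\<lambda>t. \<Sum>y | (x, y) \<in> edges G. weight G x y * t y"
  have "?S (\<lambda>y. f y * g y - f x * g x) = (\<Sum>y | (x, y) \<in> edges G.
      f x * (weight G x y * (g y - g x)) + g x * (weight G x y * (f y - f x))
      + weight G x y * (f y - f x) * (g y - g x))"
    by (rule sum.cong) (auto simp: algebra_simps)
  also have "\<dots> = f x * ?S (\<lambda>y. g y - g x) + g x * ?S (\<lambda>y. f y - f x)
      + (\<Sum>y | (x, y) \<in> edges G. weight G x y * (f y - f x) * (g y - g x))"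
    by (simp only: sum.distrib sum_distrib_left)
  finally show ?thesis
    unfolding Gamma_def laplacian_def by (simp add: algebra_simps add_divide_distrib)
qed

lemma weight_nonneg_edge:
  assumes "weighted_graph G" "(x, y) \<in> edges G"
  shows "weight G x y \<ge> 0"
proof -
  interpret weighted_graph G by fact
  show ?thesis using assms(2) edges_subset weight_nonneg by blast
qed

lemma Gamma_nonneg:
  assumes "weighted_graph G" "\<mu> x \<ge> 0"
  shows "Gamma G \<mu> f f x \<ge> 0"
  unfolding Gamma_eq_sum
  using assms
  by (auto intro!: mult_nonneg_nonneg divide_nonneg_nonneg sum_nonneg
      simp: mult.assoc weight_nonneg_edge simp flip: power2_eq_square)

section \<open>The operators on a Cartesian product\<close>

text \<open>
  The horizontal and the vertical edges at a vertex can share only a loop. Requiring \<open>t\<close> to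
  vanish at the vertex makes that loop harmless.
\<close>

lemma sum_neighbours_cart_prod:
  assumes fin: "finite {x'. (x, x') \<in> edges G}" "finite {y'. (y, y') \<in> edges H}"
    and V: "x \<in> verts G" "y \<in> verts H" and t0: "t (x, y) = (0::real)"
  shows "(\<Sum>q | ((x, y), q) \<in> edges (cart_prod G H). weight (cart_prod G H) (x, y) q * t q) =
    (\<Sum>x' | (x, x') \<in> edges G. weight G x x' * t (x', y)) +
    (\<Sum>y' | (y, y') \<in> edges H. weight H y y' * t (x, y'))"
proof -
  let ?A = "(\<lambda>x'. (x', y)) ` {x'. (x, x') \<in> edges G}"
  let ?B = "Pair x ` {y'. (y, y') \<in> edges H}"
  let ?w = "\<lambda>q. weight (cart_prod G H) (x, y) q * t q"
  have "{q. ((x, y), q) \<in> edges (cart_prod G H)} = ?A \<union> ?B"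
    using V by (auto simp: cart_prod_def)
  moreover have "sum ?w (?A \<union> ?B) + sum ?w (?A \<inter> ?B) = sum ?w ?A + sum ?w ?B"
    using fin by (intro sum.union_inter) auto
  moreover have "sum ?w (?A \<inter> ?B) = 0"
    using t0 by (intro sum.neutral) auto
  moreover have "sum ?w ?A = (\<Sum>x' | (x, x') \<in> edges G. weight G x x' * t (x', y))"
    using t0 by (subst sum.reindex) (auto simp: cart_prod_def inj_on_def intro!: sum.cong)
  moreover have "sum ?w ?B = (\<Sum>y' | (y, y') \<in> edges H. weight H y y' * t (x, y'))"
    by (subst sum.reindex) (auto simp: cart_prod_def inj_on_def intro!: sum.cong)
  ultimately show ?thesis by simp
qed

lemma laplacian_cart_prod:
  assumes "locally_finite G" "locally_finite H" "x \<in> verts G" "y \<in> verts H"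
  shows "laplacian (cart_prod G H) (\<lambda>_. 1) F (x, y) =
    laplacian G (\<lambda>_. 1) (\<lambda>z. F (z, y)) x + laplacian H (\<lambda>_. 1) (\<lambda>z. F (x, z)) y"
  using sum_neighbours_cart_prod[of x G y H "\<lambda>q. F q - F (x, y)"] assms
  by (simp add: laplacian_def locally_finite_def)

lemma Gamma_cart_prod:
  assumes "locally_finite G" "locally_finite H" "x \<in> verts G" "y \<in> verts H"
  shows "Gamma (cart_prod G H) (\<lambda>_. 1) E F (x, y) =
    Gamma G (\<lambda>_. 1) (\<lambda>z. E (z, y)) (\<lambda>z. F (z, y)) x
    + Gamma H (\<lambda>_. 1) (\<lambda>z. E (x, z)) (\<lambda>z. F (x, z)) y"
  unfolding Gamma_def laplacian_cart_prod[OF assms] by (simp add: algebra_simps)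

text \<open>
  Half of this mixed term is the contribution of the Laplacian of \<open>G\<close> and the \<open>\<Gamma>\<close> of
  \<open>H\<close> to \<open>\<Gamma>\<^sub>2\<close> of the product. With \<open>a = f x' y' - f x' y\<close> and \<open>b = f x y' - f x y\<close>,
  its summand is \<open>(a\<^sup>2 - b\<^sup>2) / 2 - b * (a - b) = (a - b)\<^sup>2 / 2\<close>.
\<close>

lemma mixed_term_nonneg:
  fixes f :: "'a \<Rightarrow> 'b \<Rightarrow> real"
  assumes "weighted_graph G" "weighted_graph H"
  shows "laplacian G (\<lambda>_. 1) (\<lambda>z. Gamma H (\<lambda>_. 1) (f z) (f z) y) x
    - 2 * Gamma H (\<lambda>_. 1) (f x) (\<lambda>z. laplacian G (\<lambda>_. 1) (\<lambda>u. f u z) x) y \<ge> 0"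
proof -
  let ?N = "{x'. (x, x') \<in> edges G}" and ?M = "{y'. (y, y') \<in> edges H}"
  let ?w = "weight G x" and ?v = "weight H y"
  let ?a = "\<lambda>x' y'. f x' y' - f x' y" and ?b = "\<lambda>y'. f x y' - f x y"
  have L: "laplacian G (\<lambda>_. 1) (\<lambda>z. Gamma H (\<lambda>_. 1) (f z) (f z) y) x =
      (\<Sum>x'\<in>?N. \<Sum>y'\<in>?M. ?w x' * ?v y' * (((?a x' y')\<^sup>2 - (?b y')\<^sup>2) / 2))"
    unfolding Gamma_eq_sum laplacian_def
    by (simp add: sum_distrib_left flip: sum_subtractf right_diff_distrib)
       (intro sum.cong; simp add: power2_eq_square field_simps)
  have "laplacian G (\<lambda>_. 1) (\<lambda>u. f u y') x - laplacian G (\<lambda>_. 1) (\<lambda>u. f u y) x =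
      (\<Sum>x'\<in>?N. ?w x' * (?a x' y' - ?b y'))" for y'
    unfolding laplacian_def
    by (simp flip: sum_subtractf) (intro sum.cong; simp add: algebra_simps)
  then have "2 * Gamma H (\<lambda>_. 1) (f x) (\<lambda>z. laplacian G (\<lambda>_. 1) (\<lambda>u. f u z) x) y =
      (\<Sum>y'\<in>?M. \<Sum>x'\<in>?N. ?w x' * ?v y' * (?b y' * (?a x' y' - ?b y')))"
    unfolding Gamma_eq_sum
    by (simp add: sum_distrib_left) (intro sum.cong; simp add: algebra_simps)
  also have "\<dots> = (\<Sum>x'\<in>?N. \<Sum>y'\<in>?M. ?w x' * ?v y' * (?b y' * (?a x' y' - ?b y')))"
    by (rule sum.swap)
  finally have "laplacian G (\<lambda>_. 1) (\<lambda>z. Gamma H (\<lambda>_. 1) (f z) (f z) y) x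
      - 2 * Gamma H (\<lambda>_. 1) (f x) (\<lambda>z. laplacian G (\<lambda>_. 1) (\<lambda>u. f u z) x) y =
      (\<Sum>x'\<in>?N. \<Sum>y'\<in>?M. ?w x' * ?v y' * ((?a x' y' - ?b y')\<^sup>2 / 2))"
    unfolding L
    by (simp flip: sum_subtractf) (intro sum.cong; simp add: power2_eq_square field_simps)
  also have "\<dots> \<ge> 0"
    using assms by (auto intro!: sum_nonneg mult_nonneg_nonneg simp: weight_nonneg_edge)
  finally show ?thesis .
qed

text \<open>
  The vertex hypotheses matter at the neighbours of \<open>(x, y)\<close> too: \<open>\<Gamma>\<^sub>2\<close> applies the operators
  twice, and the splitting of the inner application is valid at vertices only.
\<close>

lemma Gamma2_cart_prod:
  assumes G: "weighted_graph G" "locally_finite G" and H: "weighted_graph H" "locally_finite H"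
    and V: "x \<in> verts G" "y \<in> verts H"
  shows "Gamma2 (cart_prod G H) (\<lambda>_. 1) F F (x, y) =
    Gamma2 G (\<lambda>_. 1) (\<lambda>z. F (z, y)) (\<lambda>z. F (z, y)) x
    + Gamma2 H (\<lambda>_. 1) (\<lambda>z. F (x, z)) (\<lambda>z. F (x, z)) y
    + 1 / 2 * (laplacian G (\<lambda>_. 1) (\<lambda>z. Gamma H (\<lambda>_. 1) (\<lambda>u. F (z, u)) (\<lambda>u. F (z, u)) y) x
      - 2 * Gamma H (\<lambda>_. 1) (\<lambda>z. F (x, z)) (\<lambda>z. laplacian G (\<lambda>_. 1) (\<lambda>u. F (u, z)) x) y)
    + 1 / 2 * (laplacian H (\<lambda>_. 1) (\<lambda>z. Gamma G (\<lambda>_. 1) (\<lambda>u. F (u, z)) (\<lambda>u. F (u, z)) x) y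
      - 2 * Gamma G (\<lambda>_. 1) (\<lambda>z. F (z, y)) (\<lambda>z. laplacian H (\<lambda>_. 1) (\<lambda>u. F (z, u)) y) x)"
proof -
  note lap = laplacian_cart_prod[OF G(2) H(2)] and Gam = Gamma_cart_prod[OF G(2) H(2)]
  have "laplacian G (\<lambda>_. 1) (\<lambda>z. Gamma (cart_prod G H) (\<lambda>_. 1) F F (z, y)) x =
      laplacian G (\<lambda>_. 1) (\<lambda>z. Gamma G (\<lambda>_. 1) (\<lambda>u. F (u, y)) (\<lambda>u. F (u, y)) z
        + Gamma H (\<lambda>_. 1) (\<lambda>u. F (z, u)) (\<lambda>u. F (z, u)) y) x"
    by (rule laplacian_cong[OF G(1) V(1)]) (rule Gam[OF _ V(2)])
  moreover have "laplacian H (\<lambda>_. 1) (\<lambda>z. Gamma (cart_prod G H) (\<lambda>_. 1) F F (x, z)) y =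
      laplacian H (\<lambda>_. 1) (\<lambda>z. Gamma G (\<lambda>_. 1) (\<lambda>u. F (u, z)) (\<lambda>u. F (u, z)) x
        + Gamma H (\<lambda>_. 1) (\<lambda>u. F (x, u)) (\<lambda>u. F (x, u)) z) y"
    by (rule laplacian_cong[OF H(1) V(2)]) (rule Gam[OF V(1)])
  moreover have "Gamma G (\<lambda>_. 1) (\<lambda>z. F (z, y))
        (\<lambda>z. laplacian (cart_prod G H) (\<lambda>_. 1) F (z, y)) x =
      Gamma G (\<lambda>_. 1) (\<lambda>z. F (z, y)) (\<lambda>z. laplacian G (\<lambda>_. 1) (\<lambda>u. F (u, y)) z
        + laplacian H (\<lambda>_. 1) (\<lambda>u. F (z, u)) y) x"
    by (rule Gamma_cong[OF G(1) V(1)]) (rule lap[OF _ V(2)])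
  moreover have "Gamma H (\<lambda>_. 1) (\<lambda>z. F (x, z))
        (\<lambda>z. laplacian (cart_prod G H) (\<lambda>_. 1) F (x, z)) y =
      Gamma H (\<lambda>_. 1) (\<lambda>z. F (x, z)) (\<lambda>z. laplacian G (\<lambda>_. 1) (\<lambda>u. F (u, z)) x
        + laplacian H (\<lambda>_. 1) (\<lambda>u. F (x, u)) z) y"
    by (rule Gamma_cong[OF H(1) V(2)]) (rule lap[OF V(1)])
  ultimately show ?thesis
    unfolding Gamma2_def
    by (simp add: lap[OF V] Gam[OF V] laplacian_add Gamma_add_right algebra_simps add_divide_distrib
        diff_divide_distrib)
qed

section \<open>Adding dimensions\<close>

text \<open>
  For finite dimensions, the difference of the two sides is
  \<open>(n * u - m * v)\<^sup>2 / (m * n * (m + n))\<close>. If one of them is infinite, so is the sum, and the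
  left-hand side vanishes.
\<close>

lemma square_add_div_le:
  fixes m n :: ereal and u v :: real
  assumes "0 < m" "0 < n"
  shows "real_of_ereal (1 / (m + n)) * (u + v)\<^sup>2 \<le>
    real_of_ereal (1 / m) * u\<^sup>2 + real_of_ereal (1 / n) * v\<^sup>2"
proof (cases "m = \<infinity> \<or> n = \<infinity>")
  case True
  then have "real_of_ereal (1 / (m + n)) = 0" by auto
  moreover have "real_of_ereal (1 / m) \<ge> 0" "real_of_ereal (1 / n) \<ge> 0"
    using assms by (auto intro!: real_of_ereal_pos)
  ultimately show ?thesis by simp
next
  case False
  then obtain a b where ab: "m = ereal a" "n = ereal b"
    using assms by (cases m; cases n) auto
  with assms have pos: "a > 0" "b > 0" by auto
  have "u\<^sup>2 / a + v\<^sup>2 / b - (u + v)\<^sup>2 / (a + b) = (b * u - a * v)\<^sup>2 / (a * b * (a + b))"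
    using pos by (simp add: divide_simps add_pos_pos) (simp add: power2_eq_square algebra_simps)
  also have "\<dots> \<ge> 0" using pos by simp
  finally show ?thesis
    using pos by (simp add: ab one_ereal_def)
qed

section \<open>Curvature-dimension bounds of Cartesian products\<close>

theorem theoremB:
  fixes G1 :: "'a wgraph" and G2 :: "'b wgraph"
    and K1 K2 :: real and n1 n2 :: ereal
  assumes "weighted_graph G1" and "locally_finite G1"
    and "weighted_graph G2" and "locally_finite G2"
    and "0 < n1" and "0 < n2"
    and "CD G1 (\<lambda>_. 1) K1 n1"
    and "CD G2 (\<lambda>_. 1) K2 n2"
  shows "CD (cart_prod G1 G2) (\<lambda>_. 1) (min K1 K2) (n1 + n2)"
  unfolding CD_def
proof (intro allI ballI)
  fix F :: "'a \<times> 'b \<Rightarrow> real" and p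
  assume "p \<in> verts (cart_prod G1 G2)"
  then obtain x y where p: "p = (x, y)" and V: "x \<in> verts G1" "y \<in> verts G2"
    by (auto simp: cart_prod_def)
  let ?f = "\<lambda>z. F (z, y)" and ?g = "\<lambda>z. F (x, z)"
  let ?u = "laplacian G1 (\<lambda>_. 1) ?f x" and ?v = "laplacian G2 (\<lambda>_. 1) ?g y"
  let ?S = "Gamma G1 (\<lambda>_. 1) ?f ?f x" and ?T = "Gamma G2 (\<lambda>_. 1) ?g ?g y"
  have "real_of_ereal (1 / (n1 + n2)) * (?u + ?v)\<^sup>2 \<le>
      real_of_ereal (1 / n1) * ?u\<^sup>2 + real_of_ereal (1 / n2) * ?v\<^sup>2"
    by (rule square_add_div_le) fact+
  moreover have "min K1 K2 * ?S \<le> K1 * ?S" "min K1 K2 * ?T \<le> K2 * ?T"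
    using assms(1,3) by (auto intro!: mult_right_mono Gamma_nonneg)
  moreover have "Gamma2 G1 (\<lambda>_. 1) ?f ?f x \<ge> real_of_ereal (1 / n1) * ?u\<^sup>2 + K1 * ?S"
    "Gamma2 G2 (\<lambda>_. 1) ?g ?g y \<ge> real_of_ereal (1 / n2) * ?v\<^sup>2 + K2 * ?T"
    using assms(7,8) V by (auto simp: CD_def)
  moreover have "Gamma2 (cart_prod G1 G2) (\<lambda>_. 1) F F p \<ge>
      Gamma2 G1 (\<lambda>_. 1) ?f ?f x + Gamma2 G2 (\<lambda>_. 1) ?g ?g y"
    unfolding p Gamma2_cart_prod[OF assms(1-4) V]
    using mixed_term_nonneg[OF assms(1,3), of "\<lambda>a b. F (a, b)" y x]
      mixed_term_nonneg[OF assms(3,1), of "\<lambda>b a. F (a, b)" x y]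
    by simp
  ultimately show "Gamma2 (cart_prod G1 G2) (\<lambda>_. 1) F F p \<ge>
      real_of_ereal (1 / (n1 + n2)) * (laplacian (cart_prod G1 G2) (\<lambda>_. 1) F p)\<^sup>2
      + min K1 K2 * Gamma (cart_prod G1 G2) (\<lambda>_. 1) F F p"
    unfolding p laplacian_cart_prod[OF assms(2,4) V] Gamma_cart_prod[OF assms(2,4) V] distrib_left
    by linarith
qed

end
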